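(* Let $\mathcal H\subset\mathbb R^2$ be a nonempty bounded open set with $B_2(0)\subset\mathcal H\subset B_{\mathcal R}(0)$ for some $\mathcal R\in(2,\infty)$. Let $J\in C^2_c(\mathbb R^2)$ be radially symmetric with $J(x)>0$ if $|x|<d$, $J(x)=0$ if $|x|\ge d$ (for some $d>0$), and $\int_{\mathbb R^2}J=1$. Then there exists a function $\phi:\mathbb R^2\to\mathbb R$ such that $$L\phi=0\ \text{ in }\mathbb R^2\setminus\mathcal H,\qquad \phi=0\ \text{ in }\mathcal H,\qquad \big(\phi(x)-\log|x|\big)\in L^\infty(\mathbb R^2\setminus\mathcal H).$$
   Context: $L$ is the operator $Lg:=J*g-g$. Functions are assumed measurable and locally bounded, so that $L$ is defined pointwise. *)

theory Defs
  imports "HOL-Analysis.Analysis"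
begin

definition C2 :: "('a::euclidean_space \<Rightarrow> real) \<Rightarrow> bool" where
  "C2 f \<longleftrightarrow>
    (\<exists>(f' :: 'a \<Rightarrow> 'a \<Rightarrow>\<^sub>L real) (f'' :: 'a \<Rightarrow> 'a \<Rightarrow>\<^sub>L 'a \<Rightarrow>\<^sub>L real).
      (\<forall>x. (f has_derivative blinfun_apply (f' x)) (at x)) \<and>
      (\<forall>x. (f' has_derivative blinfun_apply (f'' x)) (at x)) \<and>
      continuous_on UNIV f'')"

definition C2c :: "('a::euclidean_space \<Rightarrow> real) \<Rightarrow> bool" where
  "C2c f \<longleftrightarrow> C2 f \<and> compact (closure {x. f x \<noteq> 0})"

definition radially_symmetric :: "('a::euclidean_space \<Rightarrow> real) \<Rightarrow> bool" where
  "radially_symmetric f \<longleftrightarrow> (\<forall>x y. norm x = norm y \<longrightarrow> f x = f y)"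

definition locally_bounded :: "('a::euclidean_space \<Rightarrow> real) \<Rightarrow> bool" where
  "locally_bounded f \<longleftrightarrow> (\<forall>K. compact K \<longrightarrow> bounded (f ` K))"

(* The Bochner integral is 0 for non-integrable integrands, so this is the convolution only
   where the integrand is integrable, e.g. everywhere if f is C2c and g is Lebesgue measurable
   and locally bounded. *)
definition conv :: "('a::euclidean_space \<Rightarrow> real) \<Rightarrow> ('a \<Rightarrow> real) \<Rightarrow> 'a \<Rightarrow> real" where
  "conv f g x = (LINT y|lebesgue. f (x - y) * g y)"

definition nonlocal_op :: "('a::euclidean_space \<Rightarrow> real) \<Rightarrow> ('a \<Rightarrow> real) \<Rightarrow> 'a \<Rightarrow> real" where
  "nonlocal_op J g x = conv J g x - g x"

definition in_Linf :: "'a measure \<Rightarrow> ('a \<Rightarrow> real) \<Rightarrow> bool" where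
  "in_Linf M f \<longleftrightarrow> f \<in> borel_measurable M \<and> (\<exists>C. AE x in M. \<bar>f x\<bar> \<le> C)"

end

theory Submission
  imports Defs
begin

text \<open>
  The function \<open>v x = max 0 (ln |x|)\<close> satisfies \<open>J * v = v\<close> for \<open>|x| \<ge> d + 1\<close>. To see this without
  integrating over circles, average over the rotations by the \<open>N\<close>-th roots of unity: identifying
  the plane with the complex numbers, the mean of \<open>ln |x - \<omega>\<^sup>k y|\<close> over \<open>k\<close> is
  \<open>ln |x\<^sup>N - y\<^sup>N| / N\<close>, which tends to \<open>ln |x|\<close> uniformly in \<open>|y| < d\<close>.

  For \<open>K\<close> large, \<open>max 0 (v - ln K)\<close> is then a subsolution. For a supersolution, let \<open>\<chi>\<close> be the
  indicator of \<open>|x| \<ge> 2\<close>. Jumping from \<open>2 \<le> |x| \<le> d + 1\<close> into the ball of radius 2 has probability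
  at least some \<open>\<delta> > 0\<close>, so \<open>J * \<chi> \<le> 1 - \<delta>\<close> there, and a large multiple of \<open>\<chi>\<close> absorbs the excess
  of \<open>J * v\<close> over \<open>v\<close>. Both are within a constant of \<open>ln |x|\<close>, and the solution is the limit of the
  increasing iteration of \<open>g \<mapsto> J * g\<close>, set to 0 on \<open>H\<close>, started at the subsolution.
\<close>

section \<open>Invariance of Lebesgue measure under isometries\<close>

text \<open>Boxes determine the measure. The preimage of a box is its image under the inverse map,
  which is again orthogonal and so preserves its volume.\<close>

lemma lborel_distr_orthogonal:
  fixes f :: "real ^ 'n::{finite,wellorder} \<Rightarrow> real ^ 'n::_"
  assumes f: "orthogonal_transformation f"
  shows "distr lborel borel f = lborel"
proof (rule sym, rule lborel_eqI)
  fix l u :: "real ^ 'n::_" assume lu: "\<And>b. b \<in> Basis \<Longrightarrow> l \<bullet> b \<le> u \<bullet> b"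
  have cont: "continuous_on UNIV f"
    using f by (simp add: orthogonal_transformation_linear linear_continuous_on linear_linear)
  then have [measurable]: "f \<in> borel \<rightarrow>\<^sub>M borel" 
    by (rule borel_measurable_continuous_onI)
  have inv: "orthogonal_transformation (inv f)"
    using f by (rule orthogonal_transformation_inv)
  have bij: "bij f"
    using f by (rule orthogonal_transformation_bij)
  have eq: "f -` box l u = inv f ` box l u"
    by (rule bij_vimage_eq_inv_image[OF bij])
  have "f -` box l u \<in> sets borel"
    using measurable_sets[OF \<open>f \<in> borel \<rightarrow>\<^sub>M borel\<close>, of "box l u"] by simp
  then have "emeasure (distr lborel borel f) (box l u) = emeasure lebesgue (inv f ` box l u)"
    by (simp add: emeasure_distr eq)
  also have "\<dots> = measure lebesgue (inv f ` box l u)"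
    using measurable_orthogonal_image[OF inv lmeasurable_box, of l u]
    by (intro emeasure_eq_ennreal_measure) (auto simp: fmeasurable_def)
  also have "\<dots> = measure lebesgue (box l u)"
    by (subst measure_orthogonal_image[OF inv]) auto
  also have "\<dots> = (\<Prod>b\<in>Basis. (u - l) \<bullet> b)"
    using lu by (simp add: measure_lborel_box_eq)
  finally show "emeasure (distr lborel borel f) (box l u) = (\<Prod>b\<in>Basis. (u - l) \<bullet> b)" .
qed simp

lemma lborel_distr_reflect:
  fixes x :: "'a::euclidean_space"
  shows "distr lborel borel (\<lambda>y. x - y) = lborel"
  using lborel_affine[of "-1" x] by (simp add: density_1)

section \<open>Roots of unity and the mean of the logarithm\<close>

text \<open>With the order a power of two, the roots pair off as \<open>c\<close> and
  \<open>- c\<close>. A pair contributes \<open>a^2 - c^2 * b^2\<close>, and the squares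
  \<open>c^2\<close> are the roots of half the order, so the induction hypothesis applies at the
  squares of \<open>a\<close> and \<open>b\<close>.\<close>

lemma prod_roots_of_unity_diff:
  fixes a b :: complex
  shows "(\<Prod>k<2^m. a - cis (2 * pi * real k / 2^m) * b) = a^(2^m) - b^(2^m)"
proof (induction m arbitrary: a b)
  case 0
  then show ?case by simp
next
  case (Suc m)
  define c where "c k = cis (2 * pi * real k / 2^Suc m)" for k :: nat
  have shift: "c (2^m + k) = - c k" for k
  proof -
    have "2 * pi * real (2^m + k) / 2^Suc m = 2 * pi * real k / 2^Suc m + pi"
      by (simp add: field_simps)
    then show ?thesis
      by (simp add: c_def complex_eq_iff)
  qed
  have sq: "c k * c k = cis (2 * pi * real k / 2^m)" for k
    by (simp add: c_def cis_mult field_simps)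
  have split: "{..<n + n} = {..<n} \<union> (+) n ` {..<n}" for n :: nat
  proof (intro set_eqI iffI)
    fix x assume "x \<in> {..<n + n}"
    then show "x \<in> {..<n} \<union> (+) n ` {..<n}"
      using image_eqI[of x "(+) n" "x - n" "{..<n}"] by (cases "x < n") auto
  qed auto
  have pair: "(a - c k * b) * (a - c (2^m + k) * b) = a\<^sup>2 - (c k * c k) * b\<^sup>2" for k
    unfolding shift by (simp add: algebra_simps power2_eq_square)
  have "(\<Prod>k<2^Suc m. a - c k * b) = (\<Prod>k<2^m + 2^m. a - c k * b)"
    by (simp add: mult_2)
  also have "\<dots> = (\<Prod>k<2^m. a - c k * b) * (\<Prod>k<2^m. a - c (2^m + k) * b)"
    unfolding split
    by (subst prod.union_disjoint) (auto simp: prod.reindex)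
  also have "\<dots> = (\<Prod>k<2^m. a\<^sup>2 - (c k * c k) * b\<^sup>2)"
    by (simp only: prod.distrib[symmetric] pair)
  also have "\<dots> = (a\<^sup>2)^(2^m) - (b\<^sup>2)^(2^m)"
    by (simp only: sq Suc.IH)
  finally show ?case
    by (simp add: c_def power_mult[symmetric])
qed

definition plane_complex :: "real ^ 2 \<Rightarrow> complex" where
  "plane_complex x = Complex (x $ 1) (x $ 2)"

definition rotation :: "real \<Rightarrow> real ^ 2 \<Rightarrow> real ^ 2" where
  "rotation t x = vector [cos t * x $ 1 - sin t * x $ 2, sin t * x $ 1 + cos t * x $ 2]"

lemma norm_plane_complex: "norm (plane_complex x) = norm x"
  by (simp add: plane_complex_def norm_complex_def norm_vec_def L2_set_def sum_2)

lemma plane_complex_diff: "plane_complex (x - y) = plane_complex x - plane_complex y"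
  by (simp add: plane_complex_def complex_eq_iff)

lemma plane_complex_rotation: "plane_complex (rotation t x) = cis t * plane_complex x"
  by (simp add: plane_complex_def rotation_def complex_eq_iff)

lemma orthogonal_transformation_rotation: "orthogonal_transformation (rotation t)"
proof -
  have "linear (rotation t)"
    by (rule linearI) (simp_all add: rotation_def vec_eq_iff forall_2 algebra_simps)
  moreover have "norm (rotation t x) = norm x" for x
    by (metis norm_plane_complex plane_complex_rotation norm_mult norm_cis mult_1)
  ultimately show ?thesis
    by (simp add: orthogonal_transformation)
qed

text \<open>The logarithms add up to that of a product of complex factors, which
  \<open>prod_roots_of_unity_diff\<close> evaluates; \<open>norm y < norm x\<close> keeps every
  factor nonzero.\<close>

lemma sum_ln_norm_rotation:
  assumes "norm y < norm x"
  shows "(\<Sum>k<2^m. ln (norm (x - rotation (2 * pi * real k / 2^m) y)))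
    = ln (norm (plane_complex x ^ 2^m - plane_complex y ^ 2^m))"
proof -
  have nz: "norm (x - rotation t y) \<noteq> 0" for t
    using assms orthogonal_transformation_norm[OF orthogonal_transformation_rotation, of t y] by auto
  have "(\<Sum>k<2^m. ln (norm (x - rotation (2 * pi * real k / 2^m) y)))
    = ln (\<Prod>k<2^m. norm (x - rotation (2 * pi * real k / 2^m) y))"
    using nz by (subst ln_prod) auto
  also have "(\<Prod>k<2^m. norm (x - rotation (2 * pi * real k / 2^m) y))
    = norm (\<Prod>k<2^m. plane_complex x - cis (2 * pi * real k / 2^m) * plane_complex y)"
    by (simp add: prod_norm[symmetric] norm_plane_complex[symmetric] plane_complex_diff
        plane_complex_rotation)
  finally show ?thesis
    by (simp add: prod_roots_of_unity_diff)
qed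

text \<open>The bound is free of \<open>m\<close> and \<open>y\<close>, so division by
  \<open>2^m\<close> makes the error of the mean vanish uniformly. It comes from
  \<open>a / (d + 1) \<le> z \<le> 2 * a\<close> for the \<open>a\<close> and \<open>z\<close>
  below, since the ratio \<open>b / a\<close> is at most \<open>d / (d + 1)\<close>.\<close>

lemma abs_sum_ln_norm_rotation_le:
  assumes "norm y < d" "d + 1 \<le> norm x"
  shows "\<bar>(\<Sum>k<2^m. ln (norm (x - rotation (2 * pi * real k / 2^m) y))) - 2^m * ln (norm x)\<bar>
    \<le> ln (d + 1) + ln 2"
proof -
  define a where "a = norm x ^ 2^m"
  define b where "b = norm y ^ 2^m"
  define z where "z = norm (plane_complex x ^ 2^m - plane_complex y ^ 2^m)"
  have pos: "0 < norm x" "0 < d"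
    using assms norm_ge_zero[of y] by linarith+
  have "norm y * (d + 1) \<le> d * norm x"
    using assms pos by (intro mult_mono) auto
  then have "norm y / norm x \<le> d / (d + 1)"
    using pos by (simp add: field_simps)
  moreover have "(norm y / norm x) ^ 2^m \<le> norm y / norm x"
    using assms pos power_decreasing[of 1 "2^m" "norm y / norm x"] by simp
  ultimately have "b / a \<le> d / (d + 1)"
    by (simp add: a_def b_def power_divide)
  moreover have "0 < a" "0 \<le> b"
    using pos by (auto simp: a_def b_def)
  ultimately have ba: "b * (d + 1) \<le> d * a"
    using pos by (simp add: field_simps)
  have "a - b \<le> z"
    unfolding z_def a_def b_def
    by (metis norm_plane_complex norm_power norm_triangle_ineq2)
  moreover have "z \<le> a + b"
    unfolding z_def a_def b_def
    by (metis norm_plane_complex norm_power norm_triangle_ineq4)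
  moreover have "b \<le> a"
    using assms by (auto simp: a_def b_def intro!: power_mono)
  ultimately have z: "a \<le> (d + 1) * z" "z \<le> 2 * a"
  proof -
    assume *: "a - b \<le> z" 
    \<comment> \<open>By \<open>ba\<close> the left side is at least \<open>a\<close>.\<close>
    have "(d + 1) * (a - b) \<le> (d + 1) * z"
      using * pos by (intro mult_left_mono) auto
    then show "a \<le> (d + 1) * z"
      using ba by (simp add: algebra_simps)
  qed auto
  have "0 < z"
    using z(1) \<open>0 < a\<close> pos by (smt (verit) zero_less_mult_pos)
  have "ln a \<le> ln (d + 1) + ln z"
    using z(1) \<open>0 < a\<close> \<open>0 < z\<close> pos by (subst ln_mult_pos[symmetric]) auto
  moreover have "ln z \<le> ln 2 + ln a"
    using z(2) \<open>0 < a\<close> \<open>0 < z\<close> by (subst ln_mult_pos[symmetric]) auto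
  moreover have "ln a = 2^m * ln (norm x)"
    using pos by (simp add: a_def ln_realpow)
  moreover have "0 \<le> ln (d + 1)" "0 \<le> ln (2::real)"
    using pos by auto
  moreover have "(\<Sum>k<2^m. ln (norm (x - rotation (2 * pi * real k / 2^m) y))) = ln z"
    unfolding z_def using assms by (intro sum_ln_norm_rotation) auto
  ultimately show ?thesis
    by linarith
qed

section \<open>Local boundedness and the truncated logarithm\<close>

lemma locally_bounded_ball:
  fixes g :: "'a::euclidean_space \<Rightarrow> real"
  assumes "locally_bounded g"
  obtains B where "\<And>y. norm y < d \<Longrightarrow> \<bar>g (x - y)\<bar> \<le> B"
proof -
  have "bounded (g ` cball x d)"
    using assms by (simp add: locally_bounded_def)
  then obtain B where B: "\<And>y. y \<in> cball x d \<Longrightarrow> \<bar>g y\<bar> \<le> B"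
    unfolding bounded_iff by (metis image_eqI real_norm_def)
  show thesis
    by (rule that[of B]) (simp add: B dist_norm)
qed

lemma locally_bounded_between:
  assumes "locally_bounded p" "locally_bounded q" "\<And>x. p x \<le> g x" "\<And>x. g x \<le> q x"
  shows "locally_bounded g"
  unfolding locally_bounded_def
proof (intro allI impI)
  fix K :: "'a set" assume K: "compact K"
  obtain A where A: "\<And>x. x \<in> K \<Longrightarrow> \<bar>p x\<bar> \<le> A"
    using assms(1) K unfolding locally_bounded_def bounded_iff by fastforce
  obtain B where B: "\<And>x. x \<in> K \<Longrightarrow> \<bar>q x\<bar> \<le> B"
    using assms(2) K unfolding locally_bounded_def bounded_iff by fastforce
  have "\<bar>g x\<bar> \<le> A + B" if "x \<in> K" for x
    using A[OF that] B[OF that] assms(3)[of x] assms(4)[of x] by linarith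
  then show "bounded (g ` K)"
    unfolding bounded_iff by auto
qed

text \<open>The truncation removes the singularity at the origin. A kernel of range \<open>d\<close>
  does not notice it from a point with \<open>norm x \<ge> d + 1\<close>, where only values outside
  the unit disc are averaged.\<close>

definition ln_plus :: "'a::real_normed_vector \<Rightarrow> real" where
  "ln_plus x = max 0 (ln (norm x))"

lemma ln_plus_eq: "1 \<le> norm x \<Longrightarrow> ln_plus x = ln (norm x)"
  by (simp add: ln_plus_def)

lemma measurable_ln_plus [measurable]: "ln_plus \<in> borel_measurable borel"
  unfolding ln_plus_def by measurable

lemma locally_bounded_const: "locally_bounded (\<lambda>_. c)"
  by (auto simp: locally_bounded_def bounded_iff)

lemma locally_bounded_ln_plus: "locally_bounded (ln_plus :: 'a::euclidean_space \<Rightarrow> real)"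
  unfolding locally_bounded_def
proof (intro allI impI)
  fix K :: "'a set" assume "compact K"
  then obtain B where "\<And>x. x \<in> K \<Longrightarrow> norm x \<le> B"
    using compact_imp_bounded[of K] unfolding bounded_iff by blast
  moreover have "\<bar>ln_plus x\<bar> \<le> norm x" for x :: 'a
    using ln_bound[of "norm x"] by (cases "x = 0") (auto simp: ln_plus_def)
  ultimately show "bounded (ln_plus ` K)"
    unfolding bounded_iff by (auto intro!: exI[of _ B] intro: order_trans)
qed

section \<open>Convolution with a radial kernel\<close>

locale radial_kernel =
  fixes J :: "real ^ 2 \<Rightarrow> real" and d :: real
  assumes continuous: "continuous_on UNIV J"
    and radial: "norm x = norm y \<Longrightarrow> J x = J y"
    and d_pos: "0 < d"
    and positive: "norm x < d \<Longrightarrow> 0 < J x"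
    and vanishes: "d \<le> norm x \<Longrightarrow> J x = 0"
    and integral_one: "(\<integral>x. J x \<partial>lborel) = 1"
begin

lemma measurable_kernel [measurable]: "J \<in> borel_measurable borel"
  using continuous by (rule borel_measurable_continuous_onI)

lemma nonneg: "0 \<le> J x"
  using positive[of x] vanishes[of x] by (cases "norm x < d") auto

text \<open>The Bochner integral of a non-integrable function is 0 by default, so integral 1 forces
  integrability.\<close>

lemma integrable_kernel: "integrable lborel J"
  using integral_one not_integrable_integral_eq[of lborel J] by auto

lemma integrable_kernel_mult:
  assumes [measurable]: "g \<in> borel_measurable borel"
    and B: "\<And>y. norm y < d \<Longrightarrow> \<bar>g y\<bar> \<le> B"
  shows "integrable lborel (\<lambda>y. J y * g y)"
proof (rule Bochner_Integration.integrable_bound[of _ "\<lambda>y. B * J y"])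
  show "AE y in lborel. norm (J y * g y) \<le> norm (B * J y)"
  proof (rule AE_I2)
    fix y
    show "norm (J y * g y) \<le> norm (B * J y)"
    proof (cases "norm y < d")
      case True
      then have "\<bar>g y\<bar> \<le> \<bar>B\<bar>"
        using B[of y] by linarith
      then have "\<bar>g y\<bar> * \<bar>J y\<bar> \<le> \<bar>B\<bar> * \<bar>J y\<bar>"
        by (intro mult_right_mono) auto
      then show ?thesis
        by (simp add: abs_mult mult.commute)
    next
      case False
      then show ?thesis
        by (simp add: vanishes)
    qed
  qed
qed (simp_all add: integrable_kernel)

lemma integrable_conv:
  assumes [measurable]: "g \<in> borel_measurable borel" and "locally_bounded g"
  shows "integrable lborel (\<lambda>y. J y * g (x - y))"
proof -
  obtain B where "\<And>y. norm y < d \<Longrightarrow> \<bar>g (x - y)\<bar> \<le> B"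
    using locally_bounded_ball[OF assms(2)] by blast
  then show ?thesis
    by (intro integrable_kernel_mult) auto
qed

text \<open>The reflection \<open>y \<mapsto> x - y\<close> preserves \<open>lborel\<close> and
  moves \<open>x\<close> from the kernel to \<open>g\<close>. The integrand is Borel, so its
  Lebesgue integral can be taken over \<open>lborel\<close>.\<close>

lemma conv_eq_lborel:
  assumes [measurable]: "g \<in> borel_measurable borel"
  shows "conv J g x = (\<integral>y. J y * g (x - y) \<partial>lborel)"
proof -
  have "conv J g x = (\<integral>y. J (x - y) * g y \<partial>lborel)"
    unfolding conv_def by (rule integral_completion) measurable
  also have "\<dots> = (\<integral>y. J (x - y) * g y \<partial>distr lborel borel (\<lambda>y. x - y))"
    by (simp only: lborel_distr_reflect)
  also have "\<dots> = (\<integral>y. J y * g (x - y) \<partial>lborel)"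
    by (subst integral_distr) auto
  finally show ?thesis .
qed

lemma measurable_conv [measurable]:
  assumes [measurable]: "g \<in> borel_measurable borel"
  shows "conv J g \<in> borel_measurable borel"
proof -
  have "(\<lambda>x. \<integral>y. J y * g (x - y) \<partial>lborel) \<in> borel_measurable borel"
    by measurable
  also have "(\<lambda>x. \<integral>y. J y * g (x - y) \<partial>lborel) = conv J g"
    by (simp add: fun_eq_iff conv_eq_lborel)
  finally show ?thesis .
qed

lemma conv_mono:
  assumes "g \<in> borel_measurable borel" "locally_bounded g"
    and "h \<in> borel_measurable borel" "locally_bounded h"
    and le: "\<And>y. norm y < d \<Longrightarrow> g (x - y) \<le> h (x - y)"
  shows "conv J g x \<le> conv J h x"
  unfolding conv_eq_lborel[OF assms(1)] conv_eq_lborel[OF assms(3)]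
proof (rule integral_mono)
  fix y
  show "J y * g (x - y) \<le> J y * h (x - y)"
    using le[of y] vanishes[of y] nonneg[of y]
    by (cases "norm y < d") (auto intro: mult_left_mono)
qed (intro integrable_conv assms)+

lemma conv_const: "conv J (\<lambda>_. c) x = c"
  using integrable_kernel by (subst conv_eq_lborel) (simp_all add: integral_one)

lemma conv_add_cmult:
  assumes g: "g \<in> borel_measurable borel" "locally_bounded g"
    and h: "h \<in> borel_measurable borel" "locally_bounded h"
  shows "conv J (\<lambda>y. g y + c * h y) x = conv J g x + c * conv J h x"
proof -
  have "conv J (\<lambda>y. g y + c * h y) x
    = (\<integral>y. J y * g (x - y) + c * (J y * h (x - y)) \<partial>lborel)"
    using g(1) h(1) by (subst conv_eq_lborel) (auto simp: algebra_simps)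
  then show ?thesis
    using integrable_conv[OF g, of x] integrable_conv[OF h, of x]
    by (simp add: conv_eq_lborel g h)
qed

text \<open>The measure is invariant under \<open>f\<close>, and \<open>J (f y) = J y\<close> by
  radial symmetry, so only the argument of \<open>g\<close> gets rotated. This is what permits
  averaging over rotations.\<close>

lemma conv_orthogonal:
  assumes [measurable]: "g \<in> borel_measurable borel" and f: "orthogonal_transformation f"
  shows "conv J g x = (\<integral>y. J y * g (x - f y) \<partial>lborel)"
proof -
  have "continuous_on UNIV f"
    using f by (simp add: orthogonal_transformation_linear linear_continuous_on linear_linear)
  then have [measurable]: "f \<in> borel \<rightarrow>\<^sub>M borel"
    by (rule borel_measurable_continuous_onI)
  have "conv J g x = (\<integral>y. J y * g (x - y) \<partial>distr lborel borel f)"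
    by (simp only: lborel_distr_orthogonal[OF f] conv_eq_lborel assms)
  also have "\<dots> = (\<integral>y. J (f y) * g (x - f y) \<partial>lborel)"
    by (subst integral_distr) auto
  also have "\<dots> = (\<integral>y. J y * g (x - f y) \<partial>lborel)"
    using f by (simp add: radial[OF orthogonal_transformation_norm])
  finally show ?thesis .
qed

section \<open>Mean value property of the logarithm\<close>

lemma conv_ln_plus:
  assumes x: "d + 1 \<le> norm x"
  shows "conv J ln_plus x = ln_plus x"
proof -
  define c where "c = ln (d + 1) + ln 2"
  have x1: "ln_plus x = ln (norm x)"
    using x d_pos by (intro ln_plus_eq) auto
  \<comment> \<open>The mean over \<open>2^m\<close> rotations leaves the convolution unchanged but
    brings the integrand within \<open>c / 2^m\<close> of a constant times the kernel; equality
    follows as \<open>m\<close> grows.\<close>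
  have bound: "\<bar>conv J ln_plus x - ln_plus x\<bar> \<le> c / 2^m" for m
  proof -
    define r where "r k = rotation (2 * pi * real k / 2^m)" for k :: nat
    have orth: "orthogonal_transformation (r k)" for k
      by (simp add: r_def orthogonal_transformation_rotation)
    \<comment> \<open>Here \<open>d + 1\<close> enters: the points \<open>x - r k y\<close> stay
      outside the unit disc, so the truncation has no effect.\<close>
    have r_eq: "ln_plus (x - r k y) = ln (norm (x - r k y))" if "norm y < d" for k y
    proof (rule ln_plus_eq)
      have "norm x - norm (r k y) \<le> norm (x - r k y)"
        by (rule norm_triangle_ineq2)
      then show "1 \<le> norm (x - r k y)"
        using that x orthogonal_transformation_norm[OF orth, of k y] by linarith
    qed
    have [measurable]: "r k \<in> borel \<rightarrow>\<^sub>M borel" for k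
      using orth[of k]
      by (intro borel_measurable_continuous_onI)
        (simp add: orthogonal_transformation_linear linear_continuous_on linear_linear)
    obtain B where B: "\<And>y. norm y < d \<Longrightarrow> \<bar>ln_plus (x - y)\<bar> \<le> B"
      using locally_bounded_ball[OF locally_bounded_ln_plus] by blast
    have int: "integrable lborel (\<lambda>y. J y * ln_plus (x - r k y))" for k
      by (rule integrable_kernel_mult[where B = B])
        (auto intro!: B simp: orthogonal_transformation_norm[OF orth])
    \<comment> \<open>By \<open>conv_orthogonal\<close> all \<open>2^m\<close> summands equal
      \<open>conv J ln_plus x\<close>.\<close>
    have "2^m * conv J ln_plus x = (\<Sum>k<2^m. \<integral>y. J y * ln_plus (x - r k y) \<partial>lborel)"
      by (simp add: conv_orthogonal[OF measurable_ln_plus orth, symmetric])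
    also have "\<dots> = (\<integral>y. J y * (\<Sum>k<2^m. ln_plus (x - r k y)) \<partial>lborel)"
      by (simp add: int sum_distrib_left)
    finally have "2^m * conv J ln_plus x - 2^m * ln_plus x
      = (\<integral>y. J y * (\<Sum>k<2^m. ln_plus (x - r k y)) \<partial>lborel) - (\<integral>y. J y * (2^m * ln_plus x) \<partial>lborel)"
      by (simp add: integral_one)
    also have "\<dots> = (\<integral>y. J y * (\<Sum>k<2^m. ln_plus (x - r k y)) - J y * (2^m * ln_plus x) \<partial>lborel)"
      using int by (intro Bochner_Integration.integral_diff[symmetric])
        (auto simp: sum_distrib_left integrable_kernel)
    also have "\<bar>\<dots>\<bar> \<le> (\<integral>y. J y * c \<partial>lborel)"
    proof (rule integral_abs_bound_integral)
      show "integrable lborel (\<lambda>y. J y * (\<Sum>k<2^m. ln_plus (x - r k y)) - J y * (2^m * ln_plus x))"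
        using int by (auto simp: sum_distrib_left integrable_kernel)
      show "integrable lborel (\<lambda>y. J y * c)"
        by (simp add: integrable_kernel)
      fix y
      show "\<bar>J y * (\<Sum>k<2^m. ln_plus (x - r k y)) - J y * (2^m * ln_plus x)\<bar> \<le> J y * c"
      proof (cases "norm y < d")
        case True
        have "\<bar>(\<Sum>k<2^m. ln_plus (x - r k y)) - 2^m * ln_plus x\<bar> \<le> c"
          using abs_sum_ln_norm_rotation_le[OF True x, of m]
          by (simp add: r_eq[OF True] x1 c_def) (simp add: r_def)
        then have "J y * \<bar>(\<Sum>k<2^m. ln_plus (x - r k y)) - 2^m * ln_plus x\<bar> \<le> J y * c"
          by (intro mult_left_mono nonneg)
        then show ?thesis
          by (simp add: right_diff_distrib[symmetric] abs_mult nonneg)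
      next
        case False
        then show ?thesis
          by (simp add: vanishes)
      qed
    qed
    also have "\<dots> = c"
      by (simp add: integral_one)
    also have "2^m * conv J ln_plus x - 2^m * ln_plus x = 2^m * (conv J ln_plus x - ln_plus x)"
      by (simp add: algebra_simps)
    finally have "2^m * \<bar>conv J ln_plus x - ln_plus x\<bar> \<le> c"
      unfolding abs_mult by simp
    then show ?thesis
      by (simp add: pos_le_divide_eq mult.commute)
  qed
  have "(\<lambda>m. c / 2^m) \<longlonglongrightarrow> 0"
    by (rule LIMSEQ_divide_realpow_zero) simp
  then have "\<bar>conv J ln_plus x - ln_plus x\<bar> \<le> 0"
    by (rule LIMSEQ_le_const) (use bound in auto)
  then show ?thesis
    by simp
qed

text \<open>A crude estimate for points near the origin. The summand 1 makes the right side
  nonnegative, so that it also dominates the truncated values.\<close>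

lemma conv_ln_plus_le: "conv J ln_plus x \<le> ln (norm x + d + 1)"
proof -
  have "conv J ln_plus x \<le> conv J (\<lambda>_. ln (norm x + d + 1)) x"
  proof (rule conv_mono)
    fix y :: "real ^ 2" assume "norm y < d"
    then have "norm (x - y) \<le> norm x + d + 1"
      using norm_triangle_ineq4[of x y] by linarith
    then show "ln_plus (x - y) \<le> ln (norm x + d + 1)"
      using d_pos norm_ge_zero[of x] by (cases "x = y") (auto simp: ln_plus_def intro!: ln_mono)
  qed (auto simp: locally_bounded_ln_plus locally_bounded_const)
  then show ?thesis
    by (simp add: conv_const)
qed

section \<open>Monotone iteration between a subsolution and a supersolution\<close>

text \<open>The map \<open>T\<close> below is monotone with \<open>p \<le> T p\<close> and
  \<open>T q \<le> q\<close>, so its iterates from \<open>p\<close> increase and stay below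
  \<open>q\<close>. Their pointwise limit is a fixed point of \<open>T\<close> by dominated
  convergence.\<close>

lemma monotone_iteration:
  assumes H [measurable]: "H \<in> sets borel"
    and p [measurable]: "p \<in> borel_measurable borel" and lp: "locally_bounded p"
    and q: "q \<in> borel_measurable borel" and lq: "locally_bounded q"
    and pq: "\<And>x. p x \<le> q x"
    and H_p: "\<And>x. x \<in> H \<Longrightarrow> p x = 0" and H_q: "\<And>x. x \<in> H \<Longrightarrow> 0 \<le> q x"
    and sub: "\<And>x. x \<notin> H \<Longrightarrow> p x \<le> conv J p x"
    and super: "\<And>x. x \<notin> H \<Longrightarrow> conv J q x \<le> q x"
  obtains \<phi> where "\<phi> \<in> borel_measurable borel" "locally_bounded \<phi>"
    "\<And>x. p x \<le> \<phi> x" "\<And>x. \<phi> x \<le> q x"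
    "\<And>x. x \<in> H \<Longrightarrow> \<phi> x = 0" "\<And>x. x \<notin> H \<Longrightarrow> conv J \<phi> x = \<phi> x"
proof -
  define T where "T g = (\<lambda>x. if x \<in> H then 0 else conv J g x)" for g
  define u where "u n = (T ^^ n) p" for n
  have u_0: "u 0 = p" and u_Suc: "u (Suc n) = T (u n)" for n
    by (simp_all add: u_def)
  have meas [measurable]: "u n \<in> borel_measurable borel" for n
  proof (induction n)
    case (Suc n)
    note Suc [measurable]
    show ?case
      unfolding u_Suc T_def by measurable
  qed (simp add: u_0)
  \<comment> \<open>Both claims go through one induction: lying between \<open>p\<close> and
    \<open>q\<close> gives the local boundedness that \<open>conv_mono\<close> requires for the next
    comparison.\<close>
  have step: "(\<forall>x. p x \<le> u n x \<and> u n x \<le> q x) \<and> (\<forall>x. u n x \<le> u (Suc n) x)" for n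
  proof (induction n)
    case 0
    then show ?case
      using pq H_p sub by (auto simp: u_Suc u_0 T_def)
  next
    case (Suc n)
    have lower: "p x \<le> u (Suc n) x" for x
      using Suc by (meson order_trans)
    have lb: "locally_bounded (u n)"
      using Suc by (intro locally_bounded_between[OF lp lq]) auto
    have upper: "u (Suc n) x \<le> q x" for x
    proof (cases "x \<in> H")
      case True
      then show ?thesis
        by (simp add: u_Suc T_def H_q)
    next
      case False
      have "conv J (u n) x \<le> conv J q x"
        using Suc by (intro conv_mono meas lb q lq) auto
      then show ?thesis
        using super[OF False] False by (simp add: u_Suc T_def)
    qed
    have lb': "locally_bounded (u (Suc n))"
      using lower upper by (rule locally_bounded_between[OF lp lq])
    have "u (Suc n) x \<le> u (Suc (Suc n)) x" for x
      using Suc conv_mono[OF meas lb meas lb', of x] by (auto simp: u_Suc[of "Suc n"] u_Suc[of n] T_def)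
    then show ?case
      using lower upper by blast
  qed
  have p_le_u: "p x \<le> u n x" and u_le_q: "u n x \<le> q x" and u_mono: "u n x \<le> u (Suc n) x" for n x
    using step by blast+
  have inc: "incseq (\<lambda>n. u n x)" for x
    by (rule incseq_SucI) (rule u_mono)
  define \<phi> where "\<phi> x = lim (\<lambda>n. u n x)" for x
  have lim: "(\<lambda>n. u n x) \<longlonglongrightarrow> \<phi> x" for x
  proof -
    obtain L where "(\<lambda>n. u n x) \<longlonglongrightarrow> L"
      using incseq_convergent[OF inc, of x "q x"] u_le_q by blast
    then show ?thesis
      unfolding \<phi>_def by (metis limI)
  qed
  have [measurable]: "\<phi> \<in> borel_measurable borel"
    by (rule borel_measurable_LIMSEQ_real[OF lim]) measurable
  have p_le: "p x \<le> \<phi> x" and le_q: "\<phi> x \<le> q x" for x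
    by (rule LIMSEQ_le_const[OF lim], use p_le_u in blast)
      (rule LIMSEQ_le_const2[OF lim], use u_le_q in blast)
  have lb: "locally_bounded \<phi>"
    using p_le le_q by (rule locally_bounded_between[OF lp lq])
  have zero: "\<phi> x = 0" if "x \<in> H" for x
  proof -
    have "u n x = 0" for n
      using that H_p by (cases n) (auto simp: u_0 u_Suc T_def)
    then show ?thesis
      using lim[of x] by (simp add: LIMSEQ_const_iff)
  qed
  \<comment> \<open>Off \<open>H\<close> the sequence \<open>u (Suc n) x = conv J (u n) x\<close>
    has two limits, one by convergence of \<open>u\<close> and one by dominated convergence with
    majorant \<open>J\<close> times \<open>\<bar>p\<bar> + \<bar>q\<bar>\<close>; they must
    agree.\<close>
  have harmonic: "conv J \<phi> x = \<phi> x" if "x \<notin> H" for x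
  proof -
    have "(\<lambda>n. \<integral>y. J y * u n (x - y) \<partial>lborel) \<longlonglongrightarrow> (\<integral>y. J y * \<phi> (x - y) \<partial>lborel)"
    proof (rule integral_dominated_convergence[where w = "\<lambda>y. J y * \<bar>p (x - y)\<bar> + J y * \<bar>q (x - y)\<bar>"])
      have "integrable lborel (\<lambda>y. \<bar>J y * p (x - y)\<bar> + \<bar>J y * q (x - y)\<bar>)"
        using integrable_conv[OF p lp, of x] integrable_conv[OF q lq, of x] by auto
      then show "integrable lborel (\<lambda>y. J y * \<bar>p (x - y)\<bar> + J y * \<bar>q (x - y)\<bar>)"
        by (simp add: abs_mult nonneg)
      show "AE y in lborel. (\<lambda>n. J y * u n (x - y)) \<longlonglongrightarrow> J y * \<phi> (x - y)"
        by (intro AE_I2 tendsto_mult_left lim)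
      fix n
      have "\<bar>u n z\<bar> \<le> \<bar>p z\<bar> + \<bar>q z\<bar>" for z
        using p_le_u[of z n] u_le_q[of n z] by linarith
      then have "J y * \<bar>u n (x - y)\<bar> \<le> J y * (\<bar>p (x - y)\<bar> + \<bar>q (x - y)\<bar>)" for y
        by (intro mult_left_mono nonneg)
      then show "AE y in lborel. norm (J y * u n (x - y)) \<le> J y * \<bar>p (x - y)\<bar> + J y * \<bar>q (x - y)\<bar>"
        by (auto simp: abs_mult nonneg algebra_simps)
    qed auto
    then have "(\<lambda>n. u (Suc n) x) \<longlonglongrightarrow> conv J \<phi> x"
      using that by (simp add: u_Suc T_def conv_eq_lborel)
    moreover have "(\<lambda>n. u (Suc n) x) \<longlonglongrightarrow> \<phi> x"
      using lim by (rule LIMSEQ_Suc)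
    ultimately show ?thesis
      by (rule LIMSEQ_unique)
  qed
  show thesis
    by (rule that[of \<phi>]) (auto simp: p_le le_q lb zero harmonic)
qed

section \<open>Barriers: supersolution and subsolution\<close>

text \<open>From each \<open>x\<close> of the annulus, a disc of jumps of radius 1/4 leads into the
  ball of radius 2. These jumps have length at most \<open>d - 1/4\<close>, where \<open>J\<close>
  has a positive minimum \<open>J z\<close>, so at least the mass \<open>J z * \<omega>\<close> is
  lost, uniformly in \<open>x\<close>.\<close>

lemma conv_indicator_far_le:
  obtains \<delta> where "0 < \<delta>"
    "\<And>x. 2 \<le> norm x \<Longrightarrow> norm x \<le> d + 1 \<Longrightarrow> conv J (indicator {y. 2 \<le> norm y}) x \<le> 1 - \<delta>"
proof (cases "1 \<le> d")
  \<comment> \<open>For \<open>d < 1\<close> no \<open>x\<close> satisfies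
    \<open>2 \<le> norm x \<le> d + 1\<close>, and any positive value of \<open>\<delta>\<close>
    serves.\<close>
  case False
  then show ?thesis
    by (intro that[of 1]) auto
next
  case True
  have "\<exists>z\<in>cball 0 (d - 1/4). \<forall>y\<in>cball 0 (d - 1/4). J z \<le> J y"
    using True by (intro continuous_attains_inf continuous_on_subset[OF continuous]) auto
  then obtain z where z: "norm z \<le> d - 1/4" "\<And>y. norm y \<le> d - 1/4 \<Longrightarrow> J z \<le> J y"
    by auto
  have Jz: "0 < J z"
    using z(1) by (intro positive) simp
  define \<omega> where "\<omega> = measure lborel (ball (0::real ^ 2) (1/4))"
  have \<omega>: "measure lborel (ball p (1/4)) = \<omega>" for p :: "real ^ 2"
    by (simp add: \<omega>_def content_ball)
  have "0 < \<omega>"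
    by (simp add: \<omega>_def content_ball)
  show ?thesis
  proof (rule that[of "J z * \<omega>"])
    show "0 < J z * \<omega>"
      using Jz \<open>0 < \<omega>\<close> by simp
    fix x :: "real ^ 2" assume x: "2 \<le> norm x" "norm x \<le> d + 1"
    \<comment> \<open>The landing point: on the ray through \<open>x\<close>, at radius 3/2. All
      points within 1/4 of it have norm below 2.\<close>
    define p where "p = (3 / (2 * norm x)) *\<^sub>R x"
    have "x \<noteq> 0"
      using x by auto
    have small: "3 / (2 * norm x) \<le> 1"
      using x by (simp add: divide_le_eq)
    have "x - p = (1 - 3 / (2 * norm x)) *\<^sub>R x"
      by (simp add: p_def algebra_simps)
    then have "norm (x - p) = \<bar>1 - 3 / (2 * norm x)\<bar> * norm x"
      by simp
    also have "\<dots> = norm x - 3/2"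
      using small \<open>x \<noteq> 0\<close> by (simp add: left_diff_distrib)
    finally have xp: "norm (x - p) = norm x - 3/2" .
    have np: "norm p = 3/2"
      using \<open>x \<noteq> 0\<close> by (simp add: p_def)
    let ?B = "ball (x - p) (1/4)"
    have int: "integrable lborel (\<lambda>y. J z * indicator ?B y)"
      using emeasure_bounded_finite[OF bounded_ball, of "x - p" "1/4"]
      by (intro integrable_mult_right integrable_real_indicator) simp_all
    have "conv J (indicator {y. 2 \<le> norm y}) x = (\<integral>y. J y * indicator {y. 2 \<le> norm y} (x - y) \<partial>lborel)"
      by (rule conv_eq_lborel) measurable
    also have "\<dots> \<le> (\<integral>y. J y - J z * indicator ?B y \<partial>lborel)"
    proof (rule integral_mono)
      show "integrable lborel (\<lambda>y. J y * indicator {y. 2 \<le> norm y} (x - y))"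
        by (rule integrable_kernel_mult[where B = 1]) (auto simp: indicator_def)
      show "integrable lborel (\<lambda>y. J y - J z * indicator ?B y)"
        using integrable_kernel int by (rule Bochner_Integration.integrable_diff)
      fix y
      show "J y * indicator {y. 2 \<le> norm y} (x - y) \<le> J y - J z * indicator ?B y"
      proof (cases "y \<in> ?B")
        case True
        then have y: "norm (x - y - p) < 1/4"
          by (simp add: dist_norm algebra_simps)
        have "norm (x - y) \<le> norm (x - y - p) + norm p"
          by (rule norm_triangle_sub[of "x - y" p, unfolded add.commute[of "norm p"]])
        then have "norm (x - y) < 2"
          using y np by simp
        \<comment> \<open>The right side is below \<open>norm x - 3/2 + 1/4\<close>, hence below
          \<open>d - 1/4\<close>.\<close>
        moreover have "norm y \<le> norm (x - p) + norm (x - y - p)"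
          using norm_triangle_ineq4[of "x - p" "x - y - p"] by simp
        then have "J z \<le> J y"
          using y xp x by (intro z(2)) simp
        ultimately show ?thesis
          using True by simp
      next
        case False
        then show ?thesis
          using nonneg[of y] by (simp add: indicator_def)
      qed
    qed
    also have "\<dots> = 1 - J z * \<omega>"
      using integrable_kernel int by (simp add: integral_one \<omega>)
    finally show "conv J (indicator {y. 2 \<le> norm y}) x \<le> 1 - J z * \<omega>" .
  qed
qed

text \<open>For \<open>norm x \<ge> d + 1\<close> the logarithm is reproduced exactly and the
  average of the indicator is at most 1. Closer in, \<open>conv_indicator_far_le\<close> gains
  \<open>C * \<delta>\<close>, which outweighs the convolution of \<open>ln_plus\<close>. The right
  side is the value of the barrier at \<open>x\<close>, because the indicator is 1 there.\<close>

lemma supersolution: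
  obtains C where "0 \<le> C"
    "\<And>x. 2 \<le> norm x \<Longrightarrow>
      conv J (\<lambda>y. ln_plus y + C * indicator {y. 2 \<le> norm y} y) x \<le> ln_plus x + C"
proof -
  let ?\<chi> = "indicator {y. 2 \<le> norm y} :: real ^ 2 \<Rightarrow> real"
  obtain \<delta> where \<delta>: "0 < \<delta>"
    "\<And>x. 2 \<le> norm x \<Longrightarrow> norm x \<le> d + 1 \<Longrightarrow> conv J ?\<chi> x \<le> 1 - \<delta>"
    using conv_indicator_far_le by blast
  \<comment> \<open>Chosen so that \<open>C * \<delta>\<close> equals the bound
    \<open>ln (2 * d + 2)\<close> that \<open>conv_ln_plus_le\<close> yields for
    \<open>norm x < d + 1\<close>.\<close>
  define C where "C = ln (2 * d + 2) / \<delta>"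
  have C: "0 \<le> C" "C * \<delta> = ln (2 * d + 2)"
    using \<delta>(1) d_pos by (auto simp: C_def)
  have \<chi> [measurable]: "?\<chi> \<in> borel_measurable borel"
    by measurable
  have l\<chi>: "locally_bounded ?\<chi>"
    by (rule locally_bounded_between[OF locally_bounded_const[of 0] locally_bounded_const[of 1]])
      (auto simp: indicator_def)
  show thesis
  proof (rule that[OF C(1)])
    fix x :: "real ^ 2" assume x: "2 \<le> norm x"
    have eq: "conv J (\<lambda>y. ln_plus y + C * ?\<chi> y) x = conv J ln_plus x + C * conv J ?\<chi> x"
      by (intro conv_add_cmult measurable_ln_plus locally_bounded_ln_plus \<chi> l\<chi>)
    show "conv J (\<lambda>y. ln_plus y + C * ?\<chi> y) x \<le> ln_plus x + C"
    proof (cases "d + 1 \<le> norm x")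
      case True
      have "conv J ?\<chi> x \<le> conv J (\<lambda>_. 1) x"
        by (intro conv_mono \<chi> l\<chi> locally_bounded_const) (auto simp: indicator_def)
      then have "C * conv J ?\<chi> x \<le> C * 1"
        using C(1) by (intro mult_left_mono) (simp_all add: conv_const)
      then show ?thesis
        using conv_ln_plus[OF True] by (simp add: eq)
    next
      case False
      have "C * conv J ?\<chi> x \<le> C * (1 - \<delta>)"
        using False x C(1) by (intro mult_left_mono \<delta>(2)) auto
      moreover have "conv J ln_plus x \<le> ln (2 * d + 2)"
      proof (rule order_trans[OF conv_ln_plus_le])
        show "ln (norm x + d + 1) \<le> ln (2 * d + 2)"
          using False d_pos x by (intro ln_mono) auto
      qed
      moreover have "0 \<le> ln_plus x"
        by (simp add: ln_plus_def)
      ultimately show ?thesis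
        using C(2) by (simp add: eq algebra_simps)
    qed
  qed
qed

text \<open>A maximum of functions inherits the inequality from whichever is larger at
  \<open>x\<close>: the constant 0 is always reproduced, and \<open>ln_plus - ln K\<close> is
  reproduced for \<open>norm x \<ge> K\<close>. For smaller \<open>norm x\<close> the maximum is
  0.\<close>

lemma subsolution:
  assumes K: "d + 1 \<le> K"
  shows "max 0 (ln_plus x - ln K) \<le> conv J (\<lambda>y. max 0 (ln_plus y - ln K)) x"
proof -
  let ?p = "\<lambda>y :: real ^ 2. max 0 (ln_plus y - ln K)"
  have p [measurable]: "?p \<in> borel_measurable borel"
    by measurable
  have "0 \<le> ln K"
    using K d_pos by simp
  then have lp: "locally_bounded ?p"
    by (intro locally_bounded_between[OF locally_bounded_const[of 0] locally_bounded_ln_plus])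
      (auto simp: ln_plus_def)
  have "conv J (\<lambda>_. 0) x \<le> conv J ?p x"
    by (intro conv_mono p lp locally_bounded_const) auto
  then have nonneg: "0 \<le> conv J ?p x"
    by (simp add: conv_const)
  show ?thesis
  proof (cases "K \<le> norm x")
    case True
    \<comment> \<open>The factor 1 puts the function in the form of \<open>conv_add_cmult\<close>,
      with a constant function as second summand.\<close>
    let ?l = "\<lambda>y :: real ^ 2. ln_plus y + (- ln K) * 1"
    have "locally_bounded ?l"
      by (rule locally_bounded_between[OF locally_bounded_const[of "- ln K"] locally_bounded_ln_plus])
        (auto simp: ln_plus_def \<open>0 \<le> ln K\<close>)
    then have "conv J ?l x \<le> conv J ?p x"
      by (intro conv_mono p lp) auto
    moreover have "conv J ?l x = ln_plus x - ln K"
      using conv_add_cmult[of ln_plus "\<lambda>_. 1" "- ln K" x] conv_ln_plus[of x] True K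
      by (simp add: locally_bounded_ln_plus locally_bounded_const conv_const)
    ultimately show ?thesis
      using nonneg by simp
  next
    case False
    then have "ln_plus x \<le> ln K"
      using K d_pos \<open>0 \<le> ln K\<close> by (cases "x = 0") (auto simp: ln_plus_def intro!: ln_mono)
    then show ?thesis
      using nonneg by simp
  qed
qed

end

section \<open>Existence of the solution with logarithmic growth\<close>

theorem proposition2p1:
  fixes H :: "(real ^ 2) set" and R d :: real and J :: "real ^ 2 \<Rightarrow> real"
  assumes "H \<noteq> {}" and "bounded H" and "open H"
    and "2 < R" and "ball 0 2 \<subseteq> H" and "H \<subseteq> ball 0 R"
    and "C2c J" and "radially_symmetric J"
    and "0 < d"
    and "\<And>x. norm x < d \<Longrightarrow> J x > 0"
    and "\<And>x. norm x \<ge> d \<Longrightarrow> J x = 0"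
    and "(LINT x|lebesgue. J x) = 1"
  shows "\<exists>\<phi> :: real ^ 2 \<Rightarrow> real.
           \<phi> \<in> borel_measurable lebesgue \<and> locally_bounded \<phi> \<and>
           (\<forall>x \<in> - H. nonlocal_op J \<phi> x = 0) \<and>
           (\<forall>x \<in> H. \<phi> x = 0) \<and>
           in_Linf (lebesgue_on (- H)) (\<lambda>x. \<phi> x - ln (norm x))"
proof -
  have cont: "continuous_on UNIV J"
  proof -
    obtain J' :: "real ^ 2 \<Rightarrow> (real ^ 2) \<Rightarrow>\<^sub>L real"
      where "\<And>x. (J has_derivative blinfun_apply (J' x)) (at x)"
      using \<open>C2c J\<close> unfolding C2c_def C2_def by blast
    then show ?thesis
      by (intro has_derivative_continuous_on) auto
  qed
  then have lborel: "(LINT x|lebesgue. J x) = (LINT x|lborel. J x)"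
    by (intro integral_completion) (simp add: borel_measurable_continuous_onI)
  interpret radial_kernel J d
  proof unfold_locales
    show "J x = J y" if "norm x = norm y" for x y
      using \<open>radially_symmetric J\<close> that unfolding radially_symmetric_def by blast
    show "(LINT x|lborel. J x) = 1"
      using assms(12) lborel by simp
  qed (fact cont assms)+
  let ?\<chi> = "indicator {y. 2 \<le> norm y} :: real ^ 2 \<Rightarrow> real"
  obtain C where C: "0 \<le> C"
    "\<And>x. 2 \<le> norm x \<Longrightarrow> conv J (\<lambda>y. ln_plus y + C * ?\<chi> y) x \<le> ln_plus x + C"
    using supersolution by blast
  \<comment> \<open>\<open>K \<ge> R\<close> makes \<open>p\<close> vanish on \<open>H\<close>;
    \<open>K \<ge> d + 1\<close> makes it a subsolution.\<close>
  define K where "K = max R (d + 1)"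
  have K: "R \<le> K" "d + 1 \<le> K" "0 \<le> ln K"
    using d_pos by (auto simp: K_def)
  define p where "p x = max 0 (ln_plus x - ln K)" for x :: "real ^ 2"
  define q where "q x = ln_plus x + C * ?\<chi> x" for x
  \<comment> \<open>Off \<open>H\<close> the indicator is therefore 1 and \<open>ln_plus\<close> is
    the logarithm itself, which is what the supersolution inequality and the final bound
    use.\<close>
  have far: "2 \<le> norm x" if "x \<notin> H" for x
    using that \<open>ball 0 2 \<subseteq> H\<close> by (force simp: subset_iff)
  have ln_plus_nonneg: "0 \<le> ln_plus x" for x :: "real ^ 2"
    by (simp add: ln_plus_def)
  have p_le: "p x \<le> ln_plus x" for x
    using K(3) ln_plus_nonneg[of x] by (simp add: p_def)
  have q_ge: "ln_plus x \<le> q x" and q_le: "q x \<le> ln_plus x + C" for x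
    using C(1) by (simp_all add: q_def indicator_def)
  have lq: "locally_bounded q"
  proof -
    have "locally_bounded (\<lambda>x :: real ^ 2. ln_plus x + C)"
      unfolding locally_bounded_def
    proof (intro allI impI)
      fix S :: "(real ^ 2) set" assume "compact S"
      then have "bounded (ln_plus ` S)"
        using locally_bounded_ln_plus unfolding locally_bounded_def by blast
      then show "bounded ((\<lambda>x. ln_plus x + C) ` S)"
        using bounded_translation[of "ln_plus ` S" C] by (simp add: image_image add.commute)
    qed
    then show ?thesis
      by (rule locally_bounded_between[OF locally_bounded_ln_plus _ q_ge q_le])
  qed
  obtain \<phi> where \<phi>: "\<phi> \<in> borel_measurable borel" "locally_bounded \<phi>"
    "\<And>x. p x \<le> \<phi> x" "\<And>x. \<phi> x \<le> q x"
    "\<And>x. x \<in> H \<Longrightarrow> \<phi> x = 0" "\<And>x. x \<notin> H \<Longrightarrow> conv J \<phi> x = \<phi> x"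
  proof (rule monotone_iteration[of H p q])
    show "H \<in> sets borel"
      using \<open>open H\<close> by simp
    show "p \<in> borel_measurable borel"
      unfolding p_def by measurable
    show "q \<in> borel_measurable borel"
      unfolding q_def by measurable
    show "locally_bounded p"
      using p_le by (intro locally_bounded_between[OF locally_bounded_const[of 0] locally_bounded_ln_plus])
        (auto simp: p_def)
    show "locally_bounded q"
      by (fact lq)
    show "p x \<le> q x" for x
      using p_le q_ge by (rule order_trans)
    show "p x = 0" if "x \<in> H" for x
    proof -
      have "norm x \<le> K"
        using that \<open>H \<subseteq> ball 0 R\<close> K(1) by (force simp: subset_iff)
      then have "ln_plus x \<le> ln K"
        using K(3) by (cases "x = 0") (auto simp: ln_plus_def intro!: ln_mono)
      then show ?thesis
        by (simp add: p_def)
    qed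
    show "0 \<le> q x" for x
      using ln_plus_nonneg q_ge by (rule order_trans)
    show "p x \<le> conv J p x" for x
      using subsolution[OF K(2)] by (simp add: p_def[abs_def])
    show "conv J q x \<le> q x" if "x \<notin> H" for x
      using C(2)[OF far[OF that]] far[OF that] by (simp add: q_def[abs_def])
  qed blast
  \<comment> \<open>The barriers enclose \<open>\<phi>\<close> between \<open>ln_plus - ln K\<close>
    and \<open>ln_plus + C\<close>.\<close>
  have bound: "\<bar>\<phi> x - ln (norm x)\<bar> \<le> C + ln K" if "x \<notin> H" for x
  proof -
    have "ln_plus x = ln (norm x)"
      using far[OF that] by (intro ln_plus_eq) simp
    moreover have "ln_plus x - ln K \<le> \<phi> x"
      using \<phi>(3)[of x] by (simp add: p_def)
    ultimately show ?thesis
      using \<phi>(4)[of x] q_le[of x] C(1) K(3) by linarith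
  qed
  have meas [measurable]: "\<phi> \<in> borel_measurable lebesgue"
    using \<phi>(1) by (intro measurable_completion) simp
  have "(\<lambda>x. \<phi> x - ln (norm x)) \<in> borel_measurable lborel"
    using \<phi>(1) by measurable
  then have "in_Linf (lebesgue_on (- H)) (\<lambda>x. \<phi> x - ln (norm x))"
    unfolding in_Linf_def using bound
    by (intro conjI exI[of _ "C + ln K"] AE_I2 measurable_restrict_space1 measurable_completion)
      (auto simp: space_restrict_space)
  then show ?thesis
    using meas \<phi> by (intro exI[of _ \<phi>]) (simp add: nonlocal_op_def)
qed

end
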